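(* Let $\mathcal N$ be one of the algebras $\langle\mathbb N;\mathrm{Suc}\rangle$, $\langle\mathbb N;+\rangle$, $\langle\mathbb N;+,\times\rangle$. For any $f\colon\mathbb N\to\mathbb N$ the following are equivalent: (i) $f$ is $\mathcal N$-stable-preorder preserving; (ii) $f$ is monotone non-decreasing and $\mathcal N$-congruence preserving; (iii) (a) $y-x$ divides $f(y)-f(x)$ for all $x,y\in\mathbb N$, (b) $f$ is either constant or $f(x)\ge x$ for all $x\in\mathbb N$, and (c) $f$ is monotone non-decreasing.
   Context: A relation on $\mathbb N$ is $\mathcal N$-stable if it is compatible with each operation of $\mathcal N$ (arguments pairwise related imply values related). $\mathcal N$-congruences are stable equivalence relations; $\mathcal N$-stable preorders are stable reflexive transitive relations. $f$ is congruence (resp. stable-preorder) preserving if for every $\mathcal N$-congruence (resp. $\mathcal N$-stable preorder) $\rho$, $x\rho y$ implies $f(x)\rho f(y)$. *)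

theory Defs
  imports Main
begin

text \<open>
  An operation on \<^typ>\<open>'a\<close> is an arity together with a function on argument lists, of which
  only the values on lists of that length matter. An algebra, whose carrier is all of \<^typ>\<open>'a\<close>,
  is given by its set of operations.
\<close>

type_synonym 'a operation = "nat \<times> ('a list \<Rightarrow> 'a)"
type_synonym 'a algebra = "'a operation set"

definition unary :: "('a \<Rightarrow> 'a) \<Rightarrow> 'a operation" where
  "unary g = (1, \<lambda>xs. g (xs ! 0))"

definition binary :: "('a \<Rightarrow> 'a \<Rightarrow> 'a) \<Rightarrow> 'a operation" where
  "binary g = (2, \<lambda>xs. g (xs ! 0) (xs ! 1))"

definition nat_Suc :: "nat algebra" where
  "nat_Suc = {unary Suc}"

definition nat_plus :: "nat algebra" where
  "nat_plus = {binary (+)}"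

definition nat_plus_times :: "nat algebra" where
  "nat_plus_times = {binary (+), binary (*)}"

definition stable :: "'a algebra \<Rightarrow> 'a rel \<Rightarrow> bool" where
  "stable \<A> \<rho> \<longleftrightarrow>
    (\<forall>(n, g) \<in> \<A>. \<forall>xs ys. length xs = n \<and> length ys = n \<and> (\<forall>i<n. (xs ! i, ys ! i) \<in> \<rho>)
      \<longrightarrow> (g xs, g ys) \<in> \<rho>)"

definition congruence :: "'a algebra \<Rightarrow> 'a rel \<Rightarrow> bool" where
  "congruence \<A> \<rho> \<longleftrightarrow> equiv UNIV \<rho> \<and> stable \<A> \<rho>"

definition stable_preorder :: "'a algebra \<Rightarrow> 'a rel \<Rightarrow> bool" where
  "stable_preorder \<A> \<rho> \<longleftrightarrow> refl \<rho> \<and> trans \<rho> \<and> stable \<A> \<rho>"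

definition preserves :: "('a \<Rightarrow> 'a) \<Rightarrow> 'a rel \<Rightarrow> bool" where
  "preserves f \<rho> \<longleftrightarrow> (\<forall>x y. (x, y) \<in> \<rho> \<longrightarrow> (f x, f y) \<in> \<rho>)"

definition congruence_preserving :: "'a algebra \<Rightarrow> ('a \<Rightarrow> 'a) \<Rightarrow> bool" where
  "congruence_preserving \<A> f \<longleftrightarrow> (\<forall>\<rho>. congruence \<A> \<rho> \<longrightarrow> preserves f \<rho>)"

definition stable_preorder_preserving :: "'a algebra \<Rightarrow> ('a \<Rightarrow> 'a) \<Rightarrow> bool" where
  "stable_preorder_preserving \<A> f \<longleftrightarrow> (\<forall>\<rho>. stable_preorder \<A> \<rho> \<longrightarrow> preserves f \<rho>)"

end

theory Submission
  imports Defs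
begin

text \<open>
  The order is a stable preorder, so preservation of stable preorders gives monotonicity.
  The congruences modulo \<open>d\<close> give (a). The Rees congruence collapsing \<open>{a..}\<close> gives (b):
  if \<open>f a < a\<close>, then \<open>f\<close> is constant from \<open>a\<close> on, hence constant, as \<open>f a - f x\<close> is then
  divisible by all large numbers. Conversely, a stable preorder containing \<open>(x, x + d)\<close>
  contains \<open>(u, u + k * d)\<close> for all \<open>u \<ge> x\<close>, and likewise for the converse pairs; by (a), (b)
  and (c), the images of two related numbers have this form.
\<close>

text \<open>Together with \<open>stable_insert_binary\<close> and \<open>stable_empty\<close>, this
  removes the argument lists from stability, one operation at a time, in each of the three
  algebras.\<close>

lemma stable_insert_unary:
  "stable (insert (unary g) \<A>) \<rho> \<longleftrightarrow> (\<forall>x y. (x, y) \<in> \<rho> \<longrightarrow> (g x, g y) \<in> \<rho>) \<and> stable \<A> \<rho>"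
proof -
  have "(\<forall>xs ys. length xs = 1 \<and> length ys = 1 \<and> (\<forall>i<1. (xs ! i, ys ! i) \<in> \<rho>)
      \<longrightarrow> (g (xs ! 0), g (ys ! 0)) \<in> \<rho>) \<longleftrightarrow> (\<forall>x y. (x, y) \<in> \<rho> \<longrightarrow> (g x, g y) \<in> \<rho>)"
    (is "?L \<longleftrightarrow> ?R")
  proof
    assume L: ?L
    show ?R
      using L[rule_format, of "[_]" "[_]"] by simp
  qed simp
  then show ?thesis
    by (simp add: stable_def unary_def)
qed

lemma stable_insert_binary:
  "stable (insert (binary g) \<A>) \<rho> \<longleftrightarrow>
    (\<forall>x y x' y'. (x, y) \<in> \<rho> \<longrightarrow> (x', y') \<in> \<rho> \<longrightarrow> (g x x', g y y') \<in> \<rho>) \<and> stable \<A> \<rho>"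
proof -
  have "(\<forall>xs ys. length xs = 2 \<and> length ys = 2 \<and> (\<forall>i<2. (xs ! i, ys ! i) \<in> \<rho>)
      \<longrightarrow> (g (xs ! 0) (xs ! 1), g (ys ! 0) (ys ! 1)) \<in> \<rho>) \<longleftrightarrow>
    (\<forall>x y x' y'. (x, y) \<in> \<rho> \<longrightarrow> (x', y') \<in> \<rho> \<longrightarrow> (g x x', g y y') \<in> \<rho>)"
    (is "?L \<longleftrightarrow> ?R")
  proof
    assume L: ?L
    show ?R
      using L[rule_format, of "[_, _]" "[_, _]"] by (simp add: less_2_cases_iff)
  qed simp
  then show ?thesis
    by (simp add: stable_def binary_def)
qed

lemma stable_empty: "stable {} \<rho>"
  by (simp add: stable_def)

lemmas stable_nat_algebra_simps =
  nat_Suc_def nat_plus_def nat_plus_times_def stable_insert_unary stable_insert_binary stable_empty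

text \<open>Adding the reflexive pair \<open>(1, 1)\<close> simulates \<open>Suc\<close>, so a
  single check against sum and product serves all three algebras.\<close>

lemma stable_nat_algebraI:
  assumes "\<N> \<in> {nat_Suc, nat_plus, nat_plus_times}"
    and "refl \<rho>"
    and "\<And>x y x' y'. (x, y) \<in> \<rho> \<Longrightarrow> (x', y') \<in> \<rho> \<Longrightarrow> (x + x', y + y') \<in> \<rho>"
    and "\<And>x y x' y'. (x, y) \<in> \<rho> \<Longrightarrow> (x', y') \<in> \<rho> \<Longrightarrow> (x * x', y * y') \<in> \<rho>"
  shows "stable \<N> \<rho>"
proof -
  have "(Suc x, Suc y) \<in> \<rho>" if "(x, y) \<in> \<rho>" for x y
    using assms(3)[OF that reflD[OF \<open>refl \<rho>\<close>, of 1]] by simp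
  then show ?thesis
    using assms by (auto simp: stable_nat_algebra_simps)
qed

lemma stable_preorder_le:
  assumes "\<N> \<in> {nat_Suc, nat_plus, nat_plus_times}"
  shows "stable_preorder \<N> {(x, y). x \<le> y}"
  unfolding stable_preorder_def
  by (intro conjI stable_nat_algebraI[OF assms])
    (auto simp: refl_on_def trans_def add_mono mult_le_mono)

lemma congruence_mod:
  assumes "\<N> \<in> {nat_Suc, nat_plus, nat_plus_times}"
  shows "congruence \<N> {(x, y). x mod d = y mod d}"
  unfolding congruence_def
  by (intro conjI stable_nat_algebraI[OF assms] equivI)
    (auto simp: refl_on_def sym_def trans_def intro: mod_add_cong mod_mult_cong)

lemma congruence_Rees:
  assumes "\<N> \<in> {nat_Suc, nat_plus, nat_plus_times}"
  shows "congruence \<N> {(x, y). x = y \<or> a \<le> x \<and> a \<le> y}"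
proof -
  \<comment> \<open>The set \<open>{a..}\<close> absorbs multiplication by every factor except 0,
    and the factor 0 makes both products equal.\<close>
  have ideal: "z * x = z * y \<or> a \<le> z * x \<and> a \<le> z * y" if "a \<le> x" "a \<le> y" for x y z :: nat
    using that by (cases z) auto
  have square: "a \<le> x * y" if "a \<le> x" "a \<le> y" for x y :: nat
    using that by (cases x) auto
  show ?thesis
    unfolding congruence_def
  proof (intro conjI stable_nat_algebraI[OF assms] equivI)
    fix x y x' y'
    assume "(x, y) \<in> {(x, y). x = y \<or> a \<le> x \<and> a \<le> y}"
      and "(x', y') \<in> {(x, y). x = y \<or> a \<le> x \<and> a \<le> y}"
    then consider "x = y" "x' = y'" | "x = y" "a \<le> x'" "a \<le> y'"
      | "x' = y'" "a \<le> x" "a \<le> y" | "a \<le> x" "a \<le> y" "a \<le> x'" "a \<le> y'"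
      by auto
    then show "(x * x', y * y') \<in> {(x, y). x = y \<or> a \<le> x \<and> a \<le> y}"
    proof cases
      case 2
      then show ?thesis
        using ideal[of x' y' x] by simp
    next
      case 3
      then show ?thesis
        using ideal[of x y x'] by (simp add: mult.commute)
    next
      case 4
      then show ?thesis
        using square by simp
    qed simp
  qed (auto simp: refl_on_def sym_def trans_def)
qed

text \<open>Translations are all that the sufficiency direction takes from the operations. Each
  algebra provides them, by iterating \<open>Suc\<close> or by adding \<open>(1, 1)\<close>
  repeatedly.\<close>

lemma stable_preorder_add:
  assumes "\<N> \<in> {nat_Suc, nat_plus, nat_plus_times}"
    and "stable_preorder \<N> \<rho>" and "(x, y) \<in> \<rho>"
  shows "(x + z, y + z) \<in> \<rho>"
proof (induction z)
  case (Suc z)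
  have one: "(1, 1) \<in> \<rho>" and stable: "stable \<N> \<rho>"
    using assms(2) by (simp_all add: stable_preorder_def reflD)
  show ?case
  proof (cases "\<N> = nat_Suc")
    case True
    with stable Suc.IH show ?thesis
      by (simp add: stable_nat_algebra_simps)
  next
    case False
    with assms(1) stable
    have "\<forall>u v u' v'. (u, v) \<in> \<rho> \<longrightarrow> (u', v') \<in> \<rho> \<longrightarrow> (u + u', v + v') \<in> \<rho>"
      by (auto simp: stable_nat_algebra_simps)
    with Suc.IH one have "(x + z + 1, y + z + 1) \<in> \<rho>"
      by blast
    then show ?thesis
      by simp
  qed
qed (simp add: assms(3))

text \<open>Reduces pairs whose first entry is the larger one to ascending pairs.\<close>

lemma stable_preorder_converse:
  assumes "stable_preorder \<N> \<rho>"
  shows "stable_preorder \<N> (\<rho>\<inverse>)"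
  using assms by (auto simp: stable_preorder_def stable_def)

lemma stable_preorder_add_mult:
  assumes "\<N> \<in> {nat_Suc, nat_plus, nat_plus_times}"
    and "stable_preorder \<N> \<rho>" and "(x, x + d) \<in> \<rho>" and "x \<le> u"
  shows "(u, u + k * d) \<in> \<rho>"
proof (induction k)
  case 0
  show ?case
    using assms(2) by (simp add: stable_preorder_def reflD)
next
  case (Suc k)
  \<comment> \<open>This translate of the given pair is the next link of the chain \<open>u\<close>,
    \<open>u + d\<close>, \<open>u + 2 * d\<close>, ...; the truncated subtraction is exact because
    \<open>x \<le> u\<close>.\<close>
  have "(x + (u + k * d - x), x + d + (u + k * d - x)) \<in> \<rho>"
    by (rule stable_preorder_add[OF assms(1-3)])
  then have "(u + k * d, u + Suc k * d) \<in> \<rho>"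
    using \<open>x \<le> u\<close> by (simp add: algebra_simps)
  with Suc.IH show ?case
    using assms(2) unfolding stable_preorder_def by (meson transD)
qed

lemma congruence_preserving_if_stable_preorder_preserving:
  assumes "stable_preorder_preserving \<A> f"
  shows "congruence_preserving \<A> f"
  using assms
  by (simp add: stable_preorder_preserving_def congruence_preserving_def stable_preorder_def
      congruence_def equiv_def)

lemma mono_if_stable_preorder_preserving:
  assumes "\<N> \<in> {nat_Suc, nat_plus, nat_plus_times}" and "stable_preorder_preserving \<N> f"
  shows "mono f"
  using assms(2) stable_preorder_le[OF assms(1)]
  unfolding stable_preorder_preserving_def preserves_def by (auto intro!: monoI)

lemma diff_dvd_if_congruence_preserving:
  assumes "\<N> \<in> {nat_Suc, nat_plus, nat_plus_times}" and "congruence_preserving \<N> f"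
  shows "(int y - int x) dvd (int (f y) - int (f x))"
proof -
  have less: "(int v - int u) dvd (int (f v) - int (f u))" if "u < v" for u v
  proof -
    \<comment> \<open>The modulus is the difference itself, which makes \<open>u\<close> and
      \<open>v\<close> congruent.\<close>
    have "u mod (v - u) = v mod (v - u)"
      using that by (metis le_add_diff_inverse less_imp_le mod_add_self2)
    then have "f u mod (v - u) = f v mod (v - u)"
      using assms(2) congruence_mod[OF assms(1), of "v - u"]
      unfolding congruence_preserving_def preserves_def by blast
    then have "int (f v) mod (int v - int u) = int (f u) mod (int v - int u)"
      using that by (metis of_nat_diff of_nat_mod less_imp_le)
    then show ?thesis
      by (simp add: mod_eq_dvd_iff)
  qed
  consider "x < y" | "x = y" | "y < x"
    by linarith
  then show ?thesis
  proof cases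
    case 3
    then show ?thesis
      using less[OF 3] by (metis dvd_minus_iff minus_diff_eq minus_dvd_iff)
  qed (use less in auto)
qed

lemma constant_or_ge_if_congruence_preserving:
  assumes "\<N> \<in> {nat_Suc, nat_plus, nat_plus_times}" and "congruence_preserving \<N> f"
  shows "(\<exists>c. \<forall>x. f x = c) \<or> (\<forall>x. f x \<ge> x)"
proof (rule disjCI)
  assume "\<not> (\<forall>x. f x \<ge> x)"
  then obtain a where a: "f a < a"
    by (auto simp: not_le)
  \<comment> \<open>Since \<open>f a < a\<close>, the Rees class of \<open>f a\<close> is a
    singleton.\<close>
  have eventually: "f y = f a" if "a \<le> y" for y
  proof -
    have "(f a, f y) \<in> {(x, y). x = y \<or> a \<le> x \<and> a \<le> y}"
      using assms(2) congruence_Rees[OF assms(1), of a] that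
      unfolding congruence_preserving_def preserves_def by blast
    with a show ?thesis
      by auto
  qed
  have "f x = f a" for x
  proof -
    \<comment> \<open>Large enough that \<open>f y = f a\<close> and that \<open>y - x\<close>
      exceeds the absolute value of \<open>f a - f x\<close>, a multiple of it that must then be
      0.\<close>
    define y where "y = a + x + f a + f x + 1"
    have "(int y - int x) dvd (int (f a) - int (f x))"
      using diff_dvd_if_congruence_preserving[OF assms, of y x] eventually[of y]
      by (simp add: y_def)
    moreover have "\<bar>int (f a) - int (f x)\<bar> < int y - int x"
      by (simp add: y_def)
    ultimately show ?thesis
      using dvd_imp_le_int[of "int (f a) - int (f x)" "int y - int x"] by force
  qed
  then show "\<exists>c. \<forall>x. f x = c"
    by blast
qed

lemma stable_preorder_preservingI:
  assumes "\<N> \<in> {nat_Suc, nat_plus, nat_plus_times}"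
    and dvd: "\<And>x y. (int y - int x) dvd (int (f y) - int (f x))"
    and ge: "\<And>x. f x \<ge> x"
    and "mono f"
  shows "stable_preorder_preserving \<N> f"
  unfolding stable_preorder_preserving_def preserves_def
proof (intro allI impI)
  fix \<rho> x y
  assume \<rho>: "stable_preorder \<N> \<rho>" and xy: "(x, y) \<in> \<rho>"
  \<comment> \<open>The relation is kept arbitrary so that this applies both to
    \<open>\<rho>\<close> and to its converse.\<close>
  have le: "(f u, f v) \<in> \<sigma>" if "stable_preorder \<N> \<sigma>" "(u, v) \<in> \<sigma>" "u \<le> v" for \<sigma> u v
  proof -
    \<comment> \<open>Monotonicity makes the natural difference of the values exact, so the quotient
      \<open>k\<close> below is a natural number.\<close>
    have "int (v - u) dvd int (f v - f u)"
      using dvd[of v u] monoD[OF \<open>mono f\<close> \<open>u \<le> v\<close>] \<open>u \<le> v\<close> by simp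
    then obtain k where "f v - f u = (v - u) * k"
      unfolding of_nat_dvd_iff by (rule dvdE)
    then have "f v = f u + k * (v - u)"
      using monoD[OF \<open>mono f\<close> \<open>u \<le> v\<close>] by (simp add: mult.commute)
    \<comment> \<open>The pair \<open>(u, v)\<close> yields chains only from starting points at or
      above \<open>u\<close>; here the start is \<open>f u\<close>, which is why \<open>ge\<close>
      is required.\<close>
    then show ?thesis
      using stable_preorder_add_mult[OF assms(1) that(1) _ ge, of u "v - u" k] that by simp
  qed
  show "(f x, f y) \<in> \<rho>"
  proof (cases "x \<le> y")
    case True
    with le \<rho> xy show ?thesis
      by blast
  next
    case False
    with le[OF stable_preorder_converse[OF \<rho>], of y x] xy show ?thesis
      by simp
  qed
qed

text \<open>Constants violate \<open>f x \<ge> x\<close> for large \<open>x\<close>, so they need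
  their own argument; reflexivity suffices.\<close>

lemma stable_preorder_preserving_const:
  assumes "\<forall>x. f x = c"
  shows "stable_preorder_preserving \<A> f"
  using assms
  by (simp add: stable_preorder_preserving_def preserves_def stable_preorder_def reflD)

theorem theorem3p10:
  fixes \<N> :: "nat algebra" and f :: "nat \<Rightarrow> nat"
  assumes "\<N> \<in> {nat_Suc, nat_plus, nat_plus_times}"
  shows "(stable_preorder_preserving \<N> f \<longleftrightarrow> mono f \<and> congruence_preserving \<N> f) \<and>
    (mono f \<and> congruence_preserving \<N> f \<longleftrightarrow>
      (\<forall>x y. (int y - int x) dvd (int (f y) - int (f x))) \<and>
      ((\<exists>c. \<forall>x. f x = c) \<or> (\<forall>x. f x \<ge> x)) \<and>
      mono f)"
proof -
  let ?pre = "stable_preorder_preserving \<N> f"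
  let ?cong = "mono f \<and> congruence_preserving \<N> f"
  let ?arith = "(\<forall>x y. (int y - int x) dvd (int (f y) - int (f x))) \<and>
      ((\<exists>c. \<forall>x. f x = c) \<or> (\<forall>x. f x \<ge> x)) \<and> mono f"
  \<comment> \<open>The equivalences follow from the cycle \<open>?pre\<close>,
    \<open>?cong\<close>, \<open>?arith\<close>, \<open>?pre\<close> of implications.\<close>
  have "?cong" if "?pre"
    using mono_if_stable_preorder_preserving[OF assms that]
      congruence_preserving_if_stable_preorder_preserving[OF that] ..
  moreover have "?arith" if "?cong"
    using that diff_dvd_if_congruence_preserving[OF assms, of f]
      constant_or_ge_if_congruence_preserving[OF assms, of f] by simp
  moreover have "?pre" if arith: "?arith"
  proof (cases "\<exists>c. \<forall>x. f x = c")
    case True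
    then show ?thesis
      by (elim exE) (rule stable_preorder_preserving_const)
  next
    case False
    with arith show ?thesis
      by (intro stable_preorder_preservingI[OF assms]) simp_all
  qed
  ultimately show ?thesis
    by argo
qed

end
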